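(* Let $2 \leq n \in \mathbb{Z}$. For $p$ an odd prime and $s \in \mathbb{F}_p^{*}$, \begin{equation*} {_{n}G_{n}} \biggl[ \begin{array}{cccccc} \frac{1}{2} & \frac{1}{2} & \dotsc & \frac{1}{2} & \frac{1}{4} & \frac{3}{4} \vspace{.05in}\\ 1 & 1 & \dotsc & 1 & 1 & 1 \end{array} \Big| \; s \; \biggr]_p = p \cdot \omega^{\frac{p-1}{2}}((-1)^{n+1}s) \cdot {_{n}G_{n}} \biggl[ \begin{array}{cccccc} \frac{1}{2} & \frac{1}{2} & \dotsc & \frac{1}{2} & \frac{1}{2} & \frac{1}{2} \vspace{.05in}\\ 1 & 1 & \dotsc & 1 & \frac{1}{4} & \frac{3}{4} \end{array} \Big| \; s^{-1} \; \biggr]_p \end{equation*} where $\omega$ is the Teichm\"{u}ller character.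
   Context: $\Gamma_p$ denotes Morita's $p$-adic gamma function and $\omega$ the Teichmüller character of $\mathbb{F}_p$ (with $\omega(x)\equiv x \pmod p$), $\bar\omega$ its inverse. For $x\in\mathbb{Q}$, $\lfloor x\rfloor$ is the floor and $\langle x\rangle = x-\lfloor x\rfloor$. For $s\in\mathbb{F}_p$ and $a_i,b_i\in\mathbb{Q}\cap\mathbb{Z}_p$, ${_{n}G_{n}}[a_1,\dots,a_n; b_1,\dots,b_n \mid s]_p := \frac{-1}{p-1}\sum_{j=0}^{p-2}(-1)^{jn}\bar\omega^j(s)\prod_{i=1}^n \frac{\Gamma_p(\langle a_i - \frac{j}{p-1}\rangle)}{\Gamma_p(\langle a_i\rangle)}\frac{\Gamma_p(\langle -b_i + \frac{j}{p-1}\rangle)}{\Gamma_p(\langle -b_i\rangle)}(-p)^{-\lfloor \langle a_i\rangle - \frac{j}{p-1}\rfloor - \lfloor \langle -b_i\rangle + \frac{j}{p-1}\rfloor}$. In the claim, the first function has $n-2$ top parameters equal to $\frac12$ followed by $\frac14,\frac34$, all bottom parameters $1$; the second has all $n$ top parameters $\frac12$ and bottom parameters $n-2$ ones followed by $\frac14,\frac34$. *)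

theory Defs
  imports
    Complex_Main
    "HOL-Computational_Algebra.Polynomial_Factorial"
    "Berlekamp_Zassenhaus.Finite_Field"
begin

section \<open>The ring of $p$-adic integers\<close>

text \<open>
  The prime \<open>p\<close> is the cardinality of the type argument \<open>'p\<close>, so that \<open>'p mod_ring\<close> is the field
  with \<open>p\<close> elements. A $p$-adic integer is an element of the inverse limit of the rings
  $\mathbb{Z}/p^n$, given by its least nonnegative residues.
\<close>

abbreviation char_p :: "'p::prime_card itself \<Rightarrow> int"
  where "char_p t \<equiv> int CARD('p)"

typedef (overloaded) ('p::prime_card) padic_int =
  "{x :: nat \<Rightarrow> int.
      \<forall>n. x n \<in> {0..<char_p TYPE('p) ^ n} \<and> x (Suc n) mod char_p TYPE('p) ^ n = x n}"
  morphisms padic_approx Abs_padic_int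
  by (rule exI[of _ "\<lambda>_. 0"]) (use nontriv[where 'a = 'p] in auto)

setup_lifting type_definition_padic_int

lemma char_p_gt_1: "char_p TYPE('p::prime_card) > 1"
  using nontriv[where 'a = 'p] by simp

lemma char_p_pow_pos: "char_p TYPE('p::prime_card) ^ n > 0"
  using char_p_gt_1[where 'p = 'p] by simp

lemma padic_approx_range:
  "0 \<le> padic_approx (x :: 'p::prime_card padic_int) n"
  "padic_approx (x :: 'p padic_int) n < char_p TYPE('p) ^ n"
  using padic_approx[of x] by auto

lemma padic_approx_mod_Suc:
  "padic_approx (x :: 'p::prime_card padic_int) (Suc n) mod char_p TYPE('p) ^ n = padic_approx x n"
  using padic_approx[of x] by auto

lemma padic_approx_mod_self [simp]:
  "padic_approx (x :: 'p::prime_card padic_int) n mod char_p TYPE('p) ^ n = padic_approx x n"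
  by (simp add: padic_approx_range)

lemma padic_approx_0 [simp]: "padic_approx x 0 = 0"
  using padic_approx_range[of x 0] by simp

lemma padic_approx_mod:
  assumes "m \<le> n"
  shows "padic_approx (x :: 'p::prime_card padic_int) n mod char_p TYPE('p) ^ m = padic_approx x m"
  using assms
proof (induction n rule: dec_induct)
  case (step n)
  have "padic_approx x (Suc n) mod char_p TYPE('p) ^ m
        = (padic_approx x (Suc n) mod char_p TYPE('p) ^ n) mod char_p TYPE('p) ^ m"
    using step.hyps by (intro mod_mod_cancel[symmetric] le_imp_power_dvd)
  then show ?case
    using step.IH by (simp add: padic_approx_mod_Suc)
qed simp

lemma padic_int_eqI:
  "(\<And>n. padic_approx x n = padic_approx y n) \<Longrightarrow> x = y"
  by (auto simp: padic_approx_inject[symmetric])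

lemma padic_int_closed:
  fixes g :: "nat \<Rightarrow> int"
  assumes "\<And>n. g (Suc n) mod char_p TYPE('p::prime_card) ^ n = g n mod char_p TYPE('p) ^ n"
  shows "g n mod char_p TYPE('p) ^ n \<in> {0..<char_p TYPE('p) ^ n} \<and>
         (g (Suc n) mod char_p TYPE('p) ^ Suc n) mod char_p TYPE('p) ^ n
         = g n mod char_p TYPE('p) ^ n"
proof -
  have "(g (Suc n) mod char_p TYPE('p) ^ Suc n) mod char_p TYPE('p) ^ n
        = g (Suc n) mod char_p TYPE('p) ^ n"
    by (intro mod_mod_cancel le_imp_power_dvd) simp
  then show ?thesis
    using assms[of n] char_p_pow_pos[where 'p = 'p, of n] by simp
qed

instantiation padic_int :: (prime_card) comm_ring_1
begin

lift_definition zero_padic_int :: "'a padic_int" is "\<lambda>_. 0"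
  using char_p_pow_pos[where 'p = 'a] by simp

lift_definition one_padic_int :: "'a padic_int" is "\<lambda>n. 1 mod char_p TYPE('a) ^ n"
  by (intro allI padic_int_closed) simp

lift_definition plus_padic_int :: "'a padic_int \<Rightarrow> 'a padic_int \<Rightarrow> 'a padic_int"
  is "\<lambda>x y n. (x n + y n) mod char_p TYPE('a) ^ n"
  by (intro allI padic_int_closed) (metis mod_add_eq mod_mod_trivial)

lift_definition minus_padic_int :: "'a padic_int \<Rightarrow> 'a padic_int \<Rightarrow> 'a padic_int"
  is "\<lambda>x y n. (x n - y n) mod char_p TYPE('a) ^ n"
  by (intro allI padic_int_closed) (metis mod_diff_eq mod_mod_trivial)

lift_definition uminus_padic_int :: "'a padic_int \<Rightarrow> 'a padic_int"
  is "\<lambda>x n. (- x n) mod char_p TYPE('a) ^ n"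
  by (intro allI padic_int_closed) (metis mod_minus_eq mod_mod_trivial)

lift_definition times_padic_int :: "'a padic_int \<Rightarrow> 'a padic_int \<Rightarrow> 'a padic_int"
  is "\<lambda>x y n. (x n * y n) mod char_p TYPE('a) ^ n"
  by (intro allI padic_int_closed) (metis mod_mult_eq mod_mod_trivial)

instance
proof
  show "(0 :: 'a padic_int) \<noteq> 1"
  proof
    assume "(0 :: 'a padic_int) = 1"
    then have "padic_approx (0 :: 'a padic_int) 1 = padic_approx (1 :: 'a padic_int) 1" by simp
    then show False
      using char_p_gt_1[where 'p = 'a]
      by (simp add: zero_padic_int.rep_eq one_padic_int.rep_eq)
  qed
qed (transfer; force simp: fun_eq_iff mod_simps algebra_simps)+

end

lemma padic_approx_of_nat:
  "padic_approx (of_nat k :: 'p::prime_card padic_int) n = int k mod char_p TYPE('p) ^ n"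
  by (induction k)
     (simp_all add: zero_padic_int.rep_eq one_padic_int.rep_eq plus_padic_int.rep_eq mod_simps
               add.commute)

instance padic_int :: (prime_card) ring_char_0
proof
  show "inj (of_nat :: nat \<Rightarrow> 'a padic_int)"
  proof (rule injI)
    fix k l :: nat
    assume eq: "(of_nat k :: 'a padic_int) = of_nat l"
    define n where "n = max k l"
    have "n < CARD('a) ^ n"
      using nontriv[where 'a = 'a] by (intro power_gt_expt) simp
    then have "int k < char_p TYPE('a) ^ n" "int l < char_p TYPE('a) ^ n"
      by (simp_all add: n_def flip: of_nat_power)
    moreover have "int k mod char_p TYPE('a) ^ n = int l mod char_p TYPE('a) ^ n"
      using eq by (metis padic_approx_of_nat)
    ultimately show "k = l" by simp
  qed
qed

instance padic_int :: (prime_card) idom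
proof
  fix x y :: "'a padic_int"
  assume "x \<noteq> 0" "y \<noteq> 0"
  then obtain m n where mn: "padic_approx x m \<noteq> 0" "padic_approx y n \<noteq> 0"
    by (metis padic_int_eqI zero_padic_int.rep_eq)
  define a b where "a = padic_approx x (m + n)" and "b = padic_approx y (m + n)"
  have nd: "\<not> char_p TYPE('a) ^ m dvd a" "\<not> char_p TYPE('a) ^ n dvd b"
    using mn padic_approx_mod[of m "m + n" x] padic_approx_mod[of n "m + n" y]
    by (auto simp: a_def b_def dvd_eq_mod_eq_0)
  have "\<not> char_p TYPE('a) ^ (m + n) dvd a * b"
  proof
    assume dvd: "char_p TYPE('a) ^ (m + n) dvd a * b"
    have p: "prime_elem (char_p TYPE('a))"
      using prime_card_int[where 'a = 'a] by simp
    have "a \<noteq> 0" "b \<noteq> 0"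
      using nd by auto
    then have "m + n \<le> multiplicity (char_p TYPE('a)) (a * b)"
      using dvd char_p_gt_1[where 'p = 'a] by (intro multiplicity_geI) auto
    also have "\<dots> = multiplicity (char_p TYPE('a)) a + multiplicity (char_p TYPE('a)) b"
      using p \<open>a \<noteq> 0\<close> \<open>b \<noteq> 0\<close> by (rule prime_elem_multiplicity_mult_distrib)
    finally have "m + n \<le> multiplicity (char_p TYPE('a)) a + multiplicity (char_p TYPE('a)) b" .
    moreover have "multiplicity (char_p TYPE('a)) a < m" "multiplicity (char_p TYPE('a)) b < n"
      using nd by (meson multiplicity_dvd' not_le)+
    ultimately show False by simp
  qed
  then have "padic_approx (x * y) (m + n) \<noteq> 0"
    by (simp add: times_padic_int.rep_eq a_def b_def dvd_eq_mod_eq_0)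
  then show "x * y \<noteq> 0"
    by (metis zero_padic_int.rep_eq)
qed


section \<open>The $p$-adic metric\<close>

lemma padic_approx_eq_mono:
  assumes "padic_approx (x :: 'p::prime_card padic_int) n = padic_approx (y :: 'p padic_int) n" "m \<le> n"
  shows "padic_approx x m = padic_approx y m"
  using padic_approx_mod[OF assms(2), of x] padic_approx_mod[OF assms(2), of y] assms(1) by simp

instantiation padic_int :: (prime_card) metric_space
begin

text \<open>
  If \<open>x \<noteq> y\<close> agree modulo $p^v$ but not modulo $p^{v+1}$, then $|x - y|_p = p^{-v}$.
\<close>

definition dist_padic_int :: "'a padic_int \<Rightarrow> 'a padic_int \<Rightarrow> real" where
  "dist x y = (if x = y then 0
     else (1 / real CARD('a)) ^ (LEAST v. padic_approx x (Suc v) \<noteq> padic_approx y (Suc v)))"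

definition uniformity_padic_int :: "('a padic_int \<times> 'a padic_int) filter" where
  "uniformity_padic_int = (INF e\<in>{0<..}. principal {(x, y). dist x y < e})"

definition open_padic_int :: "'a padic_int set \<Rightarrow> bool" where
  "open_padic_int U \<longleftrightarrow> (\<forall>x\<in>U. \<forall>\<^sub>F (x', y) in uniformity. x' = x \<longrightarrow> y \<in> U)"

lemma dist_padic_int_le_iff:
  "dist (x :: 'a padic_int) y \<le> (1 / real CARD('a)) ^ n \<longleftrightarrow> padic_approx x n = padic_approx y n"
proof (cases "x = y")
  case False
  define P where "P = (\<lambda>v. padic_approx x (Suc v) \<noteq> padic_approx y (Suc v))"
  define v where "v = (LEAST v. P v)"
  have "\<exists>v. P v"
  proof -
    obtain k where "padic_approx x k \<noteq> padic_approx y k"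
      using False padic_int_eqI by blast
    then show ?thesis
      by (cases k) (auto simp: P_def)
  qed
  then have v: "P v"
    unfolding v_def by (rule LeastI_ex)
  have less: "\<not> P k" if "k < v" for k
    using that unfolding v_def by (rule not_less_Least)
  have "dist x y = (1 / real CARD('a)) ^ v"
    using False by (simp add: dist_padic_int_def v_def P_def)
  moreover have "(1 / real CARD('a)) ^ v \<le> (1 / real CARD('a)) ^ n \<longleftrightarrow> n \<le> v"
    using nontriv[where 'a = 'a] by (intro power_decreasing_iff) auto
  moreover have "n \<le> v \<longleftrightarrow> padic_approx x n = padic_approx y n"
  proof
    assume "n \<le> v"
    then show "padic_approx x n = padic_approx y n"
      using less[of "n - 1"] by (cases n) (auto simp: P_def)
  next
    assume "padic_approx x n = padic_approx y n"
    then show "n \<le> v"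
      using v padic_approx_eq_mono[of x n y "Suc v"] by (fastforce simp: P_def not_less_eq_eq)
  qed
  ultimately show ?thesis by simp
qed (simp add: dist_padic_int_def)

instance
proof
  fix x y z :: "'a padic_int"
  show "dist x y = 0 \<longleftrightarrow> x = y"
    by (simp add: dist_padic_int_def)
  have comm: "dist a b = dist b a" for a b :: "'a padic_int"
    by (auto simp: dist_padic_int_def eq_commute)
  have power: "a = b \<or> (\<exists>n. dist a b = (1 / real CARD('a)) ^ n)" for a b :: "'a padic_int"
    by (auto simp: dist_padic_int_def)
  have nonneg: "0 \<le> dist a b" for a b :: "'a padic_int"
    by (simp add: dist_padic_int_def)
  have "dist x y \<le> max (dist x z) (dist y z)"
  proof (cases "x = z \<or> y = z")
    case False
    then obtain m n where "dist x z = (1 / real CARD('a)) ^ m" "dist y z = (1 / real CARD('a)) ^ n"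
      using power by blast
    moreover from this have "padic_approx x m = padic_approx z m" "padic_approx y n = padic_approx z n"
      using dist_padic_int_le_iff by (metis order_refl)+
    then have "padic_approx x (min m n) = padic_approx y (min m n)"
      by (metis min.cobounded1 min.cobounded2 padic_approx_eq_mono)
    then have "dist x y \<le> (1 / real CARD('a)) ^ min m n"
      by (simp add: dist_padic_int_le_iff)
    ultimately show ?thesis
      by (auto simp: min_def split: if_splits)
  qed (auto simp: comm nonneg max_def)
  then show "dist x y \<le> dist x z + dist y z"
    using nonneg[of x z] nonneg[of y z] by linarith
qed (fact uniformity_padic_int_def open_padic_int_def)+

end


section \<open>The field of $p$-adic numbers\<close>

instance fract :: ("{idom, ring_char_0}") ring_char_0
  by standard (auto simp: inj_def of_nat_fract eq_fract)

instance fract :: ("{idom, ring_char_0}") field_char_0 ..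

type_synonym 'p padic = "'p padic_int fract"

text \<open>
  A rational number as a $p$-adic integer; meaningful only if \<open>p\<close> does not divide the denominator.
\<close>

definition padic_int_of_rat :: "rat \<Rightarrow> 'p::prime_card padic_int" where
  "padic_int_of_rat r = (THE x. to_fract x = of_rat r)"


section \<open>Morita's $p$-adic gamma function\<close>

text \<open>
  The limit is taken over natural numbers \<open>n\<close> tending to \<open>x\<close> in the $p$-adic topology. The formula
  gives the value \<open>1\<close> for \<open>n = 0\<close>.
\<close>

definition padic_Gamma :: "'p::prime_card padic_int \<Rightarrow> 'p padic_int" where
  "padic_Gamma x = Lim (filtercomap of_nat (nhds x))
     (\<lambda>n. (- 1) ^ n * of_nat (\<Prod>{j \<in> {0<..<n}. \<not> CARD('p) dvd j}))"


section \<open>The Teichmueller character\<close>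

text \<open>
  Multiplicative characters of the field, including the trivial one, are extended by \<open>0\<close> at \<open>0\<close>.
\<close>

definition mult_character :: "('p::prime_card mod_ring \<Rightarrow> 'b::comm_ring_1) \<Rightarrow> bool" where
  "mult_character \<chi> \<longleftrightarrow> \<chi> 0 = 0 \<and> \<chi> 1 = 1 \<and> (\<forall>x y. \<chi> (x * y) = \<chi> x * \<chi> y)"

definition character_power ::
    "('p::prime_card mod_ring \<Rightarrow> 'b::comm_ring_1) \<Rightarrow> nat \<Rightarrow> 'p mod_ring \<Rightarrow> 'b" where
  "character_power \<chi> j x = (if x = 0 then 0 else \<chi> x ^ j)"

definition padic_residue :: "'p::prime_card padic_int \<Rightarrow> 'p mod_ring" where
  "padic_residue x = of_int (padic_approx x 1)"

definition teichmuller_int :: "'p::prime_card mod_ring \<Rightarrow> 'p padic_int" where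
  "teichmuller_int = (THE \<chi>. mult_character \<chi> \<and> (\<forall>x. padic_residue (\<chi> x) = x))"

definition teichmuller :: "'p::prime_card mod_ring \<Rightarrow> 'p padic" where
  "teichmuller x = to_fract (teichmuller_int x)"

definition teichmuller_bar :: "'p::prime_card mod_ring \<Rightarrow> 'p padic" where
  "teichmuller_bar x = inverse (teichmuller x)"


section \<open>The $p$-adic hypergeometric function ${}_nG_n$\<close>

definition padic_Gamma_rat :: "rat \<Rightarrow> 'p::prime_card padic" where
  "padic_Gamma_rat r = to_fract (padic_Gamma (padic_int_of_rat r))"

text \<open>
  The parameter lists are meant to have the same length \<open>n\<close> and entries with denominators prime
  to \<open>p\<close>; then \<open>padic_Gamma_rat\<close> is applied to $p$-adic integers only.
\<close>

definition padic_G :: "rat list \<Rightarrow> rat list \<Rightarrow> 'p::prime_card mod_ring \<Rightarrow> 'p padic" where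
  "padic_G as bs s = (let p = CARD('p); n = length as in
     (- 1) / of_nat (p - 1) *
     (\<Sum>j = 0..p - 2. (- 1) ^ (j * n) * character_power teichmuller_bar j s *
       (\<Prod>i<n. let a = as ! i; b = bs ! i; t = of_nat j / of_nat (p - 1) in
          padic_Gamma_rat (frac (a - t)) / padic_Gamma_rat (frac a) *
          (padic_Gamma_rat (frac (- b + t)) / padic_Gamma_rat (frac (- b))) *
          (- of_nat p) powi (- \<lfloor>frac a - t\<rfloor> - \<lfloor>frac (- b) + t\<rfloor>))))"

end

theory Submission
  imports Defs "HOL-Number_Theory.Residue_Primitive_Roots"
begin

text \<open>
  Put \<open>t = j / (p - 1)\<close> on the left and substitute \<open>k \<equiv> (p - 1) / 2 - j\<close> modulo \<open>p - 1\<close> on the right,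
  so that \<open>t\<close> becomes the fractional part of \<open>1/2 - t\<close>. This exchanges the gamma factors with
  arguments \<open>t\<close> and \<open>1/2 - t\<close>, and the two sums then agree term by term up to a sign, the factor
  $-p$ gained from the floors, and $\Gamma_p(1/2)^2$. The latter equals $-(-1)^{(p-1)/2}$ and
  $\Gamma_p(0) = 1$; both values come from Wilson's theorem modulo $p^m$, which also provides the
  continuity of $\Gamma_p$.
\<close>

section \<open>Wilson's theorem modulo odd prime powers\<close>

text \<open>As p is odd, it cannot divide both y - 1 and y + 1. So p^m, which divides their product,
  is coprime to one factor and divides the other.\<close>

lemma odd_prime_power_square_eq_one:
  fixes y :: int and p m :: nat
  assumes "prime p" "odd p" "[y\<^sup>2 = 1] (mod int (p ^ m))"
  shows "[y = 1] (mod int (p ^ m)) \<or> [y = -1] (mod int (p ^ m))"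
proof -
  have p: "prime (int p)" "\<not> int p dvd 2"
  proof -
    have "\<not> p dvd 2"
      using assms primes_dvd_imp_eq[OF _ two_is_prime_nat] by auto
    then show "\<not> int p dvd 2"
      by (metis int_dvd_int_iff of_nat_numeral)
  qed (use assms in simp)
  have d: "int p ^ m dvd (y - 1) * (y + 1)"
    using assms(3) by (simp add: cong_iff_dvd_diff power2_eq_square algebra_simps)
  have "\<not> (int p dvd y - 1 \<and> int p dvd y + 1)"
  proof
    assume "int p dvd y - 1 \<and> int p dvd y + 1"
    then have "int p dvd (y + 1) - (y - 1)"
      by (meson dvd_diff)
    with p(2) show False by simp
  qed
  then consider "coprime (int p ^ m) (y - 1)" | "coprime (int p ^ m) (y + 1)"
    using p(1) prime_imp_coprime coprime_power_left_iff by blast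
  then show ?thesis
    by cases (use d in \<open>auto simp: cong_iff_dvd_diff coprime_dvd_mult_right_iff coprime_dvd_mult_left_iff\<close>)
qed

text \<open>For m = 0 this would fail: 1 is a totative of 1, but the right-hand set is
  empty.\<close>

lemma totatives_prime_power_eq:
  assumes "prime p" "m > 0"
  shows "totatives (p ^ m) = {j \<in> {0<..<p ^ m}. \<not> p dvd j}"
proof -
  have "coprime j (p ^ m) \<longleftrightarrow> \<not> p dvd j" for j
    using assms prime_imp_coprime[of p j] not_coprimeI[of p j p]
    by (auto simp: coprime_commute)
  moreover have "p dvd p ^ m"
    using assms by simp
  ultimately show ?thesis
    by (auto simp: totatives_def order.order_iff_strict)
qed

text \<open>With a primitive root g the product becomes a power of g whose exponent is 0 + ... + (t
  - 1). This is an odd power of g^(t/2), a square root of 1 other than 1, hence -1.\<close>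

lemma wilson_odd_prime_power:
  assumes "prime p" "odd p" "m > 0"
  shows "[(\<Prod>j\<in>totatives (p ^ m). int j) = -1] (mod int (p ^ m))"
proof -
  define n where "n = p ^ m"
  define t where "t = totient n"
  have "p > 2"
    using assms prime_gt_1_nat[of p] by (cases "p = 2") auto
  moreover have "p \<le> n"
    using assms \<open>p > 2\<close> by (simp add: n_def self_le_power)
  ultimately have "n > 2" by simp
  obtain g where g: "residue_primroot n g"
    using residue_primroot_odd_prime_power_exists[OF assms(1,2)] assms(3) unfolding n_def by metis
  have "even t" "t > 0"
    using \<open>n > 2\<close> by (auto simp: t_def totient_even)
  then obtain h where h: "t = 2 * h" "h > 0" by (elim evenE) auto
  have bij: "bij_betw (\<lambda>k. g ^ k mod n) {..<t} (totatives n)"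
    using residue_primroot_is_generator[OF _ g] \<open>n > 2\<close> by (simp add: t_def)
  have "[(int (g ^ h))\<^sup>2 = 1] (mod int n)"
  proof -
    have "[g ^ t = 1] (mod n)"
      using g euler_theorem[of g n] by (auto simp: t_def residue_primroot_def coprime_commute)
    then have "[int (g ^ t) = int 1] (mod int n)"
      by (simp only: cong_int_iff)
    then show ?thesis
      by (simp add: h(1) power_even_eq)
  qed
  \<comment> \<open>The order of g is t, which exceeds h = t/2 > 0.\<close>
  moreover have "\<not> [int (g ^ h) = 1] (mod int n)"
  proof
    assume "[int (g ^ h) = 1] (mod int n)"
    then have "[g ^ h = 1] (mod n)"
      by (metis cong_int_iff of_nat_1)
    then have "t dvd h"
      using g ord_divides[of g h n] by (simp add: residue_primroot_def t_def)
    with h show False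
      using dvd_imp_le by fastforce
  qed
  ultimately have gh: "[int (g ^ h) = -1] (mod int n)"
    using odd_prime_power_square_eq_one[OF assms(1,2)] unfolding n_def by blast
  have "(\<Prod>j\<in>totatives n. int j) = (\<Prod>k<t. int (g ^ k mod n))"
    using prod.reindex_bij_betw[OF bij, of int] by simp
  also have "[\<dots> = (\<Prod>k<t. int (g ^ k))] (mod int n)"
    by (intro cong_prod) (simp add: cong_def of_nat_mod)
  also have "(\<Prod>k<t. int (g ^ k)) = int g ^ (\<Sum>k<t. k)"
    by (simp add: power_sum)
  also have "(\<Sum>k<t. k) = h * (t - 1)"
    using gauss_sum_nat[of "t - 1"] h
    by (simp add: lessThan_Suc_atMost[symmetric] atLeast0AtMost)
  also have "int g ^ (h * (t - 1)) = int (g ^ h) ^ (t - 1)"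
    by (simp add: power_mult)
  also have "[\<dots> = (-1) ^ (t - 1)] (mod int n)"
    using gh by (rule cong_pow)
  also have "(-1) ^ (t - 1) = (-1 :: int)"
    using \<open>even t\<close> \<open>t > 0\<close> by simp
  finally show ?thesis
    by (simp add: n_def)
qed

section \<open>Morita's $p$-adic gamma function\<close>

text \<open>The sequence in the limit that defines \<open>padic_Gamma\<close>, kept in the integers
  so that it can be studied by congruences.\<close>

definition morita_fact :: "nat \<Rightarrow> nat \<Rightarrow> int" where
  "morita_fact p n = (-1) ^ n * int (\<Prod>{j \<in> {0<..<n}. \<not> p dvd j})"

lemma morita_fact_0 [simp]: "morita_fact p 0 = 1"
  by (simp add: morita_fact_def)

text \<open>The functional equation of Gamma_p at natural numbers: the factor is -n at units and -1
  at multiples of p.\<close>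

lemma morita_fact_Suc:
  "morita_fact p (Suc n) = - morita_fact p n * (if p dvd n then 1 else int n)"
proof (cases "p dvd n")
  case True
  then have "{j \<in> {0<..<Suc n}. \<not> p dvd j} = {j \<in> {0<..<n}. \<not> p dvd j}"
    by (auto simp: less_Suc_eq)
  with True show ?thesis
    by (simp add: morita_fact_def)
next
  case False
  then have "{j \<in> {0<..<Suc n}. \<not> p dvd j} = insert n {j \<in> {0<..<n}. \<not> p dvd j}"
    by (auto simp: less_Suc_eq intro!: Nat.gr0I)
  with False show ?thesis
    by (simp add: morita_fact_def)
qed

text \<open>Induction on n: the base case is Wilson's theorem, its -1 cancelling the sign
  (-1)^(p^m). The recursion preserves the congruence because n and n + p^m are congruent and both or
  neither are divisible by p.\<close>

lemma morita_fact_add_prime_power: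
  assumes "prime p" "odd p"
  shows "[morita_fact p (n + p ^ m) = morita_fact p n] (mod int (p ^ m))"
proof (cases "m = 0")
  case False
  show ?thesis
  proof (induction n)
    case 0
    have "odd (p ^ m)"
      using assms by simp
    then have "morita_fact p (p ^ m) = - (\<Prod>j\<in>totatives (p ^ m). int j)"
      using False assms by (simp add: morita_fact_def totatives_prime_power_eq)
    also have "[\<dots> = - (-1)] (mod int (p ^ m))"
      using wilson_odd_prime_power[OF assms] False by (simp only: cong_minus_minus_iff)
    finally show ?case by simp
  next
    case (Suc n)
    have "p dvd n + p ^ m \<longleftrightarrow> p dvd n"
      using False by (simp add: dvd_add_left_iff)
    moreover have "[int (n + p ^ m) = int n] (mod int (p ^ m))"
      by (simp add: cong_def)
    ultimately show ?case
      using Suc.IH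
      by (auto simp del: of_nat_add of_nat_power simp: morita_fact_Suc cong_minus_minus_iff intro!: cong_mult)
  qed
qed simp

text \<open>Repeated shifts by p^m reduce both arguments to the same residue. This is uniform
  continuity in the p-adic topology.\<close>

lemma morita_fact_cong:
  assumes "prime p" "odd p" "[n = n'] (mod p ^ m)"
  shows "[morita_fact p n = morita_fact p n'] (mod int (p ^ m))"
proof -
  have *: "[morita_fact p (n + k * p ^ m) = morita_fact p n] (mod int (p ^ m))" for n k
  proof (induction k)
    case (Suc k)
    have "n + Suc k * p ^ m = (n + k * p ^ m) + p ^ m"
      by simp
    then show ?case
      using morita_fact_add_prime_power[OF assms(1,2), of "n + k * p ^ m" m] Suc.IH cong_trans
      by metis
  qed simp
  have "[morita_fact p n = morita_fact p (n mod p ^ m)] (mod int (p ^ m))" for n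
    using *[of "n mod p ^ m" "n div p ^ m"] by (simp add: mod_div_mult_eq)
  then show ?thesis
    using assms(3) unfolding cong_def by metis
qed

text \<open>(p^m + 1)/2 represents 1/2 modulo p^m. Pairing j with p^m - j turns Wilson's product
  into the square of its lower half, up to the sign (-1)^(number of pairs).\<close>

lemma morita_fact_half_square:
  assumes "prime p" "odd p" "m > 0"
  shows "[(morita_fact p ((p ^ m + 1) div 2))\<^sup>2 = - ((-1) ^ ((p - 1) div 2))] (mod int (p ^ m))"
proof -
  define N where "N = p ^ m"
  define S where "S = {j \<in> {0<..<(N + 1) div 2}. \<not> p dvd j}"
  have "odd N"
    using assms by (simp add: N_def)
  have "p dvd N"
    using assms by (simp add: N_def)
  have fin: "finite S"
    by (simp add: S_def)
  have le: "j < N" if "j \<in> S" for j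
    using that by (auto simp: S_def)
  have T: "totatives N = S \<union> (\<lambda>j. N - j) ` S"
  proof -
    have "j \<in> S \<union> (\<lambda>j. N - j) ` S" if "j \<in> totatives N" for j
    proof (cases "j < (N + 1) div 2")
      case False
      have j: "0 < j" "j < N" "\<not> p dvd j"
        using that assms by (auto simp: N_def totatives_prime_power_eq)
      then have "\<not> p dvd N - j"
        using \<open>p dvd N\<close> by (metis dvd_diffD1 less_imp_le)
      with j False have "N - j \<in> S"
        using \<open>odd N\<close> by (auto simp: S_def elim!: oddE)
      moreover have "j = N - (N - j)"
        using j by simp
      ultimately show ?thesis by blast
    qed (use that assms in \<open>auto simp: S_def N_def totatives_prime_power_eq\<close>)
    moreover have "N - j \<in> totatives N" if "j \<in> S" for j
      using that le[OF that] assms \<open>p dvd N\<close>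
      by (auto simp: S_def totatives_prime_power_eq N_def dest: dvd_diffD1)
    moreover have "S \<subseteq> totatives N"
      using le assms by (auto simp: S_def totatives_prime_power_eq N_def)
    ultimately show ?thesis by blast
  qed
  have disj: "S \<inter> (\<lambda>j. N - j) ` S = {}"
    by (auto simp: S_def)
  have inj: "inj_on (\<lambda>j. N - j) S"
    using le by (auto simp: inj_on_def) (metis diff_diff_cancel less_imp_le)
  have "totient N = 2 * card S"
    unfolding totient_def T using fin disj inj by (simp add: card_Un_disjoint card_image)
  moreover have "totient N = p ^ (m - 1) * (p - 1)"
    using assms by (simp add: N_def totient_prime_power)
  ultimately have "card S = p ^ (m - 1) * ((p - 1) div 2)"
    using assms by (auto elim!: oddE)
  \<comment> \<open>The factor p^(m-1) is odd and does not affect the parity.\<close>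
  then have par: "(-1) ^ card S = ((-1) ^ ((p - 1) div 2) :: int)"
    using assms by (simp add: power_mult)
  define P where "P = (\<Prod>j\<in>S. int j)"
  have "(\<Prod>j\<in>totatives N. int j) = P * (\<Prod>j\<in>S. int (N - j))"
    unfolding T using fin disj inj by (simp add: prod.union_disjoint prod.reindex P_def)
  also have "[\<dots> = P * (\<Prod>j\<in>S. - int j)] (mod int N)"
    by (intro cong_mult cong_refl cong_prod) (use le in \<open>force simp: cong_iff_dvd_diff of_nat_diff\<close>)
  also have "P * (\<Prod>j\<in>S. - int j) = (-1) ^ ((p - 1) div 2) * P\<^sup>2"
    by (simp add: prod_uminus par P_def power2_eq_square)
  finally have "[(-1) ^ ((p - 1) div 2) * P\<^sup>2 = -1] (mod int N)"
    using wilson_odd_prime_power[OF assms] unfolding N_def by (metis cong_sym cong_trans)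
  then have "[(-1) ^ ((p - 1) div 2) * ((-1) ^ ((p - 1) div 2) * P\<^sup>2) = (-1) ^ ((p - 1) div 2) * -1] (mod int N)"
    by (intro cong_mult cong_refl)
  moreover have "(-1) ^ ((p - 1) div 2) * ((-1) ^ ((p - 1) div 2) * P\<^sup>2) = P\<^sup>2"
    by (simp add: mult.assoc[symmetric] power_mult_distrib[symmetric])
  moreover have "(morita_fact p ((N + 1) div 2))\<^sup>2 = P\<^sup>2"
    by (simp add: morita_fact_def P_def S_def power_mult_distrib flip: power_even_eq)
  ultimately show ?thesis
    by (simp add: N_def)
qed

section \<open>Coherent sequences, limits along the natural numbers, and the truncations of
  Gamma_p\<close>

lemma padic_int_of_seq:
  fixes g :: "nat \<Rightarrow> int"
  assumes "\<And>n. [g (Suc n) = g n] (mod char_p TYPE('p::prime_card) ^ n)"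
  obtains x :: "'p::prime_card padic_int" where "\<And>n. padic_approx x n = g n mod char_p TYPE('p) ^ n"
proof
  show "padic_approx (Abs_padic_int (\<lambda>n. g n mod char_p TYPE('p) ^ n) :: 'p padic_int) n
          = g n mod char_p TYPE('p) ^ n" for n
    using padic_int_closed[of g] assms by (subst Abs_padic_int_inverse) (auto simp: cong_def)
qed

lemma padic_approx_of_int:
  "padic_approx (of_int k :: 'p::prime_card padic_int) n = k mod char_p TYPE('p) ^ n"
  by (cases k rule: int_cases2)
     (simp_all add: padic_approx_of_nat uminus_padic_int.rep_eq mod_simps)

lemma padic_approx_power:
  "padic_approx ((x :: 'p::prime_card padic_int) ^ k) n = padic_approx x n ^ k mod char_p TYPE('p) ^ n"
  by (induction k) (simp_all add: one_padic_int.rep_eq times_padic_int.rep_eq mod_simps)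

lemma ex_power_inverse_card_less:
  assumes "e > 0"
  shows "\<exists>k. (1 / real CARD('p::prime_card)) ^ k < e"
  using real_arch_pow_inv[OF assms, of "1 / real CARD('p)"] nontriv[where 'a = 'p] by simp

text \<open>The natural numbers are dense in the p-adic integers: the truncation of x modulo p^k
  lies within p^(-k) of x. A nontrivial filter makes the limit in \<open>padic_Gamma\<close>
  unique.\<close>

lemma of_nat_tends_to_padic_int: "filtercomap of_nat (nhds (x :: 'p::prime_card padic_int)) \<noteq> bot"
proof
  assume "filtercomap of_nat (nhds x) = bot"
  then have "eventually (\<lambda>_::nat. False) (filtercomap of_nat (nhds x))"
    by simp
  then obtain Q where Q: "eventually Q (nhds x)" "\<And>n::nat. \<not> Q (of_nat n)"
    by (auto simp: eventually_filtercomap)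
  then obtain e where e: "e > 0" "\<And>y. dist y x < e \<Longrightarrow> Q y"
    by (auto simp: eventually_nhds_metric)
  obtain k where k: "(1 / real CARD('p)) ^ k < e"
    using ex_power_inverse_card_less e(1) by blast
  have "dist (of_nat (nat (padic_approx x k))) x \<le> (1 / real CARD('p)) ^ k"
    unfolding dist_padic_int_le_iff padic_approx_of_nat by (simp add: padic_approx_range)
  with k e Q show False
    by (meson le_less_trans)
qed

text \<open>The congruences for \<open>morita_fact\<close> make its values at the truncations of x
  coherent, so they define some L. Naturals close to x agree with a truncation modulo p^k, so the
  defining sequence converges to L. Identities for Gamma_p thus become integer congruences.\<close>

lemma padic_approx_Gamma:
  fixes x :: "'p::prime_card padic_int"
  assumes "odd CARD('p)"
  shows "padic_approx (padic_Gamma x) m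
    = morita_fact CARD('p) (nat (padic_approx x m)) mod char_p TYPE('p) ^ m"
proof -
  let ?f = "\<lambda>m. morita_fact CARD('p) (nat (padic_approx x m))"
  have p: "prime CARD('p)"
    by (rule prime_card)
  have cong: "[morita_fact CARD('p) n = ?f m] (mod char_p TYPE('p) ^ m)"
    if "[int n = padic_approx x m] (mod char_p TYPE('p) ^ m)" for n m
  proof -
    have "[int n = int (nat (padic_approx x m))] (mod int (CARD('p) ^ m))"
      using that by (simp add: padic_approx_range)
    then have "[n = nat (padic_approx x m)] (mod CARD('p) ^ m)"
      by (simp only: cong_int_iff)
    then show ?thesis
      using morita_fact_cong[OF p assms] by simp
  qed
  have "[?f (Suc m) = ?f m] (mod char_p TYPE('p) ^ m)" for m
    by (rule cong) (simp add: cong_def padic_approx_range padic_approx_mod_Suc)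
  then obtain L :: "'p padic_int" where L: "\<And>m. padic_approx L m = ?f m mod char_p TYPE('p) ^ m"
    by (rule padic_int_of_seq) blast
  have "((\<lambda>n. of_int (morita_fact CARD('p) n)) \<longlongrightarrow> L) (filtercomap of_nat (nhds x))"
  proof (rule tendstoI)
    fix e :: real
    assume "e > 0"
    then obtain k where k: "(1 / real CARD('p)) ^ k < e"
      using ex_power_inverse_card_less by blast
    have "eventually (\<lambda>y. dist y x < (1 / real CARD('p)) ^ k) (nhds x)"
      unfolding eventually_nhds_metric using nontriv[where 'a = 'p]
      by (intro exI[of _ "(1 / real CARD('p)) ^ k"]) simp
    then have "eventually (\<lambda>n. dist (of_nat n) x < (1 / real CARD('p)) ^ k) (filtercomap of_nat (nhds x))"
      by (rule eventually_filtercomapI)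
    then show "eventually (\<lambda>n. dist (of_int (morita_fact CARD('p) n)) L < e) (filtercomap of_nat (nhds x))"
    proof eventually_elim
      case (elim n)
      then have "dist (of_nat n) x \<le> (1 / real CARD('p)) ^ k"
        by simp
      then have "[int n = padic_approx x k] (mod char_p TYPE('p) ^ k)"
        by (simp add: dist_padic_int_le_iff padic_approx_of_nat cong_def)
      from cong[OF this] have "dist (of_int (morita_fact CARD('p) n)) L \<le> (1 / real CARD('p)) ^ k"
        by (simp add: dist_padic_int_le_iff padic_approx_of_int L cong_def)
      with k show ?case by simp
    qed
  qed
  then have "padic_Gamma x = L"
    unfolding padic_Gamma_def
    by (intro tendsto_Lim of_nat_tends_to_padic_int) (simp add: morita_fact_def)
  then show ?thesis
    by (simp add: L)
qed

lemma padic_Gamma_0: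
  assumes "odd CARD('p::prime_card)"
  shows "padic_Gamma (0 :: 'p::prime_card padic_int) = 1"
  by (rule padic_int_eqI)
     (simp add: padic_approx_Gamma[OF assms] zero_padic_int.rep_eq one_padic_int.rep_eq)

text \<open>For m > 0 the truncation of x modulo p^m is (p^m + 1)/2, where the square is already
  known.\<close>

lemma padic_Gamma_half_square:
  assumes odd: "odd CARD('p::prime_card)" and x: "2 * (x :: 'p::prime_card padic_int) = 1"
  shows "(padic_Gamma x)\<^sup>2 = - ((-1) ^ ((CARD('p) - 1) div 2))"
proof (rule padic_int_eqI)
  fix m
  let ?N = "CARD('p) ^ m"
  have *: "[(morita_fact CARD('p) (nat (padic_approx x m)))\<^sup>2 = - ((-1) ^ ((CARD('p) - 1) div 2))]
    (mod int ?N)"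
  proof (cases "m = 0")
    case False
    let ?a = "padic_approx x m"
    have "padic_approx (of_nat 2 * x) m = padic_approx (1 :: 'p padic_int) m"
      using x by simp
    then have "(2 * ?a) mod int ?N = 1 mod int ?N"
      by (simp only: times_padic_int.rep_eq padic_approx_of_nat one_padic_int.rep_eq) (simp add: mod_simps)
    then have "int ?N dvd 2 * ?a - 1"
      by (simp only: mod_eq_dvd_iff)
    then obtain c where c: "2 * ?a - 1 = int ?N * c"
      by (elim dvdE)
    have r: "0 \<le> ?a" "?a < int ?N"
      by (simp_all add: padic_approx_range)
    have "?N > 1"
      using False nontriv[where 'a = 'p] by (intro one_less_power) simp_all
    then have pos: "0 < int ?N"
      by linarith
    \<comment> \<open>The bounds on the truncation leave c = 0 or c = 1, and c = 0 would make 1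
      even.\<close>
    have "c = 1"
    proof -
      have "int ?N * c < int ?N * 2" "int ?N * c > int ?N * (-1)"
        using r c \<open>?N > 1\<close> by linarith+
      then have "c < 2" "c > -1"
        by (simp_all only: mult_less_cancel_left_pos[OF pos])
      moreover have "c \<noteq> 0"
      proof
        assume "c = 0"
        with c have "2 * ?a = 1" by simp
        then show False by presburger
      qed
      ultimately show ?thesis by simp
    qed
    with c r have "int (2 * nat ?a) = int (?N + 1)"
      by simp
    then have "2 * nat ?a = ?N + 1"
      by (simp only: of_nat_eq_iff)
    then have "nat ?a = (?N + 1) div 2"
      by linarith
    with morita_fact_half_square[OF prime_card odd] False show ?thesis
      by simp
  qed simp
  have "padic_approx ((padic_Gamma x)\<^sup>2) m
      = padic_approx (of_int (- ((-1) ^ ((CARD('p) - 1) div 2))) :: 'p padic_int) m"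
    unfolding padic_approx_power padic_approx_Gamma[OF odd] padic_approx_of_int
    using * by (simp add: cong_def mod_simps)
  then show "padic_approx ((padic_Gamma x)\<^sup>2) m
      = padic_approx (- ((-1) ^ ((CARD('p) - 1) div 2)) :: 'p padic_int) m"
    by simp
qed

section \<open>Gamma_p at the rational numbers 0 and 1/2\<close>

lemma padic_int_of_rat_eqI: "to_fract x = of_rat r \<Longrightarrow> padic_int_of_rat r = x"
  unfolding padic_int_of_rat_def by (rule the_equality) (use to_fract_eq_iff in metis)+

lemma padic_Gamma_rat_0:
  assumes "odd CARD('p::prime_card)"
  shows "padic_Gamma_rat 0 = (1 :: 'p::prime_card padic)"
  by (simp add: padic_Gamma_rat_def padic_int_of_rat_eqI[of 0] padic_Gamma_0[OF assms])

lemma padic_Gamma_rat_half_square: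
  assumes odd: "odd CARD('p::prime_card)"
  shows "(padic_Gamma_rat (1/2))\<^sup>2 = (- ((-1) ^ ((CARD('p) - 1) div 2)) :: 'p::prime_card padic)"
proof -
  have half: "2 * ((char_p TYPE('p) ^ n + 1) div 2) = char_p TYPE('p) ^ n + 1" for n
    by (rule dvd_mult_div_cancel) (use odd in simp)
  \<comment> \<open>Coherence of the residues (p^n + 1)/2, which will define the p-adic integer 1/2;
    it suffices to check the doubled congruence, as 2 is a unit modulo p^n.\<close>
  have "[(char_p TYPE('p) ^ Suc n + 1) div 2 = (char_p TYPE('p) ^ n + 1) div 2] (mod char_p TYPE('p) ^ n)" for n
  proof -
    have "[2 * ((char_p TYPE('p) ^ Suc n + 1) div 2) = 2 * ((char_p TYPE('p) ^ n + 1) div 2)]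
      (mod char_p TYPE('p) ^ n)"
      unfolding half by (simp add: cong_def mod_simps)
    moreover have "coprime 2 (char_p TYPE('p) ^ n)"
      using odd by simp
    ultimately show ?thesis
      using cong_mult_lcancel by blast
  qed
  then obtain x :: "'p padic_int"
    where x: "\<And>n. padic_approx x n = ((char_p TYPE('p) ^ n + 1) div 2) mod char_p TYPE('p) ^ n"
    by (rule padic_int_of_seq) blast
  have "of_int 2 * x = 1"
  proof (rule padic_int_eqI)
    show "padic_approx (of_int 2 * x) n = padic_approx (1 :: 'p padic_int) n" for n
      unfolding times_padic_int.rep_eq one_padic_int.rep_eq padic_approx_of_int x mod_mult_eq half
      by simp
  qed
  then have x2: "2 * x = 1" by simp
  then have "2 * to_fract x = to_fract 1"
    by (metis one_add_one to_fract_1 to_fract_add to_fract_mult)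
  then have "to_fract x = of_rat (1/2)"
    by (simp add: of_rat_divide field_simps)
  then have "padic_Gamma_rat (1/2) = to_fract (padic_Gamma x)"
    by (simp add: padic_Gamma_rat_def padic_int_of_rat_eqI)
  moreover have "to_fract (y ^ k) = to_fract y ^ k" for y :: "'p padic_int" and k
    by (induction k) simp_all
  ultimately show ?thesis
    using arg_cong[OF padic_Gamma_half_square[OF odd x2], of to_fract] by simp
qed

section \<open>The Teichmueller character\<close>

text \<open>In a^p - b^p = (a - b) * (sum of p terms), each term is congruent to b^(p-1) modulo p,
  so the sum contributes one more factor p.\<close>

lemma cong_power_prime_Suc:
  fixes a b :: int
  assumes "[a = b] (mod int p ^ Suc k)"
  shows "[a ^ p = b ^ p] (mod int p ^ Suc (Suc k))"
proof -
  have ab: "[a = b] (mod int p)"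
    by (rule cong_dvd_modulus[OF assms]) simp
  have "[(\<Sum>i<p. b ^ (p - Suc i) * a ^ i) = (\<Sum>i<p. b ^ (p - Suc i) * b ^ i)] (mod int p)"
    by (intro cong_sum cong_mult cong_pow ab cong_refl)
  also have "(\<Sum>i<p. b ^ (p - Suc i) * b ^ i) = (\<Sum>i<p. b ^ (p - 1))"
    by (intro sum.cong) (auto simp flip: power_add)
  also have "[\<dots> = 0] (mod int p)"
    by (simp add: cong_def)
  finally have "int p dvd (\<Sum>i<p. b ^ (p - Suc i) * a ^ i)"
    by (simp add: cong_0_iff)
  moreover have "int p ^ Suc k dvd a - b"
    using assms by (simp add: cong_iff_dvd_diff)
  ultimately have "int p ^ Suc k * int p dvd (a - b) * (\<Sum>i<p. b ^ (p - Suc i) * a ^ i)"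
    by (intro mult_dvd_mono)
  then show ?thesis
    by (simp add: cong_iff_dvd_diff power_diff_sumr2 mult.commute)
qed

lemma cong_power_prime_power:
  fixes a b :: int
  assumes "[a = b] (mod int p)"
  shows "[a ^ p ^ n = b ^ p ^ n] (mod int p ^ Suc n)"
proof (induction n)
  case (Suc n)
  show ?case
    using cong_power_prime_Suc[OF Suc.IH] by (simp add: power_mult[symmetric] mult.commute)
qed (use assms in simp)

lemma of_int_to_int_mod_ring [simp]: "of_int (to_int_mod_ring x) = (x :: 'p::prime_card mod_ring)"
  by (simp add: of_int_of_int_mod_ring)

lemma of_int_mod_ring_eq_iff:
  "(of_int a :: 'p::prime_card mod_ring) = of_int b \<longleftrightarrow> [a = b] (mod char_p TYPE('p))"
  by (simp add: of_int_eq_iff_cong_CHAR)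

lemma mod_ring_power_card: "(x :: 'p::prime_card mod_ring) ^ CARD('p) = x"
  using finite_field_power_card_eq_same[of x] by simp

lemma padic_residue_eq_iff:
  "padic_residue (x :: 'p::prime_card padic_int) = padic_residue y \<longleftrightarrow> padic_approx x 1 = padic_approx y 1"
  using padic_approx_mod_self[of x 1] padic_approx_mod_self[of y 1]
  by (simp add: padic_residue_def of_int_mod_ring_eq_iff cong_def)

text \<open>
  A fixed point of the \<open>p\<close>-th power map is determined by its residue, because the map
  improves a congruence modulo $p^k$ to one modulo $p^{k+1}$.
\<close>

lemma power_card_fixed_point_unique:
  fixes u v :: "'p::prime_card padic_int"
  assumes "u ^ CARD('p) = u" "v ^ CARD('p) = v" "padic_residue u = padic_residue v"
  shows "u = v"
proof -
  have *: "padic_approx u (Suc n) = padic_approx v (Suc n)" for n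
  proof (induction n)
    case 0
    show ?case
      using assms(3) by (simp add: padic_residue_eq_iff)
  next
    case (Suc n)
    have "[padic_approx u (Suc (Suc n)) = padic_approx v (Suc (Suc n))] (mod char_p TYPE('p) ^ Suc n)"
      using Suc.IH by (simp only: cong_def padic_approx_mod_Suc)
    from cong_power_prime_Suc[OF this]
    have "padic_approx (u ^ CARD('p)) (Suc (Suc n)) = padic_approx (v ^ CARD('p)) (Suc (Suc n))"
      by (simp only: padic_approx_power cong_def)
    then show ?case
      by (simp only: assms)
  qed
  show ?thesis
  proof (rule padic_int_eqI)
    show "padic_approx u n = padic_approx v n" for n
      by (cases n) (simp_all only: * padic_approx_0)
  qed
qed

lemma mult_character_power:
  "mult_character \<chi> \<Longrightarrow> \<chi> (x ^ n) = \<chi> x ^ n"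
  by (induction n) (simp_all add: mult_character_def)

text \<open>The lift of x is the limit of r^(p^n) for an integer representative r of x. Fermat's
  little theorem and the lifting of congruences under p-th powers give coherence, and
  multiplicativity is checked in the same way.\<close>

lemma teichmuller_int_exists:
  "\<exists>\<chi> :: 'p::prime_card mod_ring \<Rightarrow> 'p padic_int. mult_character \<chi> \<and> (\<forall>x. padic_residue (\<chi> x) = x)"
proof -
  let ?p = "CARD('p)"
  have "\<exists>u :: 'p padic_int. \<forall>n. padic_approx u n = to_int_mod_ring x ^ ?p ^ n mod int ?p ^ n"
    for x :: "'p mod_ring"
  proof -
    have "[to_int_mod_ring x ^ ?p = to_int_mod_ring x] (mod int ?p)"
      by (simp add: of_int_mod_ring_eq_iff[symmetric] mod_ring_power_card)
    then have "[(to_int_mod_ring x ^ ?p) ^ ?p ^ n = to_int_mod_ring x ^ ?p ^ n] (mod int ?p ^ Suc n)" for n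
      by (rule cong_power_prime_power)
    then have "[(to_int_mod_ring x ^ ?p) ^ ?p ^ n = to_int_mod_ring x ^ ?p ^ n] (mod int ?p ^ n)" for n
      by (rule cong_dvd_modulus) simp
    then have "[to_int_mod_ring x ^ ?p ^ Suc n = to_int_mod_ring x ^ ?p ^ n] (mod int ?p ^ n)" for n
      by (simp add: power_mult)
    then show ?thesis
      by (rule padic_int_of_seq) blast
  qed
  then obtain \<chi> :: "'p mod_ring \<Rightarrow> 'p padic_int"
    where \<chi>: "\<And>x n. padic_approx (\<chi> x) n = to_int_mod_ring x ^ ?p ^ n mod int ?p ^ n"
    by metis
  have "\<chi> (x * y) = \<chi> x * \<chi> y" for x y
  proof (rule padic_int_eqI)
    fix n
    have "[to_int_mod_ring (x * y) = to_int_mod_ring x * to_int_mod_ring y] (mod int ?p)"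
      by (simp add: of_int_mod_ring_eq_iff[symmetric])
    from cong_power_prime_power[OF this, of n]
    have "[to_int_mod_ring (x * y) ^ ?p ^ n
        = (to_int_mod_ring x * to_int_mod_ring y) ^ ?p ^ n] (mod int ?p ^ n)"
      by (rule cong_dvd_modulus) simp
    then show "padic_approx (\<chi> (x * y)) n = padic_approx (\<chi> x * \<chi> y) n"
      by (simp add: \<chi> times_padic_int.rep_eq cong_def power_mult_distrib mod_simps)
  qed
  moreover have "\<chi> 0 = 0" "\<chi> 1 = 1"
    by (auto intro!: padic_int_eqI simp: \<chi> zero_padic_int.rep_eq one_padic_int.rep_eq power_0_left)
  moreover have "padic_residue (\<chi> x) = x" for x
  proof -
    \<comment> \<open>The first approximation is r^p rather than r; Fermat's little theorem returns
      the residue x.\<close>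
    have "padic_residue (\<chi> x) = of_int (to_int_mod_ring x ^ ?p)"
      unfolding padic_residue_def \<chi> power_one_right of_int_mod_ring_eq_iff by (simp add: cong_def)
    then show ?thesis
      by (simp add: mod_ring_power_card)
  qed
  ultimately show ?thesis
    unfolding mult_character_def by blast
qed

text \<open>Uniqueness, which justifies the definite description: x^p = x makes every value of such
  a character a fixed point of the p-th power map, and these are determined by their
  residues.\<close>

lemma teichmuller_int:
  "mult_character (teichmuller_int :: 'p::prime_card mod_ring \<Rightarrow> 'p padic_int)"
  "padic_residue (teichmuller_int x) = (x :: 'p::prime_card mod_ring)"
proof -
  have "\<chi> = \<chi>'" if "mult_character \<chi>" "\<forall>x. padic_residue (\<chi> x) = x"
    "mult_character \<chi>'" "\<forall>x. padic_residue (\<chi>' x) = x"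
    for \<chi> \<chi>' :: "'p mod_ring \<Rightarrow> 'p padic_int"
  proof
    fix x
    have "\<chi> x ^ CARD('p) = \<chi> x" "\<chi>' x ^ CARD('p) = \<chi>' x"
      using that(1,3)[THEN mult_character_power, of x "CARD('p)"] by (simp_all only: mod_ring_power_card)
    then show "\<chi> x = \<chi>' x"
      by (rule power_card_fixed_point_unique) (simp only: that(2,4)[rule_format])
  qed
  then have "\<exists>!\<chi> :: 'p mod_ring \<Rightarrow> 'p padic_int. mult_character \<chi> \<and> (\<forall>x. padic_residue (\<chi> x) = x)"
    using teichmuller_int_exists by blast
  from theI'[OF this] show "mult_character (teichmuller_int :: 'p mod_ring \<Rightarrow> 'p padic_int)"
    "padic_residue (teichmuller_int x) = x"
    unfolding teichmuller_int_def by blast+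
qed

lemma mult_character_teichmuller: "mult_character (teichmuller :: 'p::prime_card mod_ring \<Rightarrow> _)"
  using teichmuller_int(1)[where 'p = 'p] by (simp add: mult_character_def teichmuller_def)

lemma teichmuller_mult: "teichmuller (x * y) = teichmuller x * teichmuller (y :: 'p::prime_card mod_ring)"
  using mult_character_teichmuller[where 'p = 'p] by (simp add: mult_character_def)

lemma teichmuller_1 [simp]: "teichmuller (1 :: 'p::prime_card mod_ring) = 1"
  using mult_character_teichmuller[where 'p = 'p] by (simp add: mult_character_def)

lemma teichmuller_eq_iff [simp]:
  "teichmuller x = teichmuller y \<longleftrightarrow> x = (y :: 'p::prime_card mod_ring)"
proof
  assume "teichmuller x = teichmuller y"
  then have "padic_residue (teichmuller_int x) = padic_residue (teichmuller_int y)"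
    by (simp only: teichmuller_def to_fract_eq_iff)
  then show "x = y"
    by (simp only: teichmuller_int(2))
qed (rule arg_cong)

lemma teichmuller_inverse:
  "x \<noteq> 0 \<Longrightarrow> teichmuller (inverse x) = inverse (teichmuller (x :: 'p::prime_card mod_ring))"
  by (rule inverse_unique[symmetric]) (simp flip: teichmuller_mult)

lemma teichmuller_power_card_minus_1:
  assumes "x \<noteq> (0 :: 'p::prime_card mod_ring)"
  shows "teichmuller x ^ (CARD('p) - 1) = 1"
proof -
  have "x * x ^ (CARD('p) - 1) = x * 1"
    using mod_ring_power_card[of x] by (simp add: power_eq_if)
  then have "x ^ (CARD('p) - 1) = 1"
    using assms by simp
  then show ?thesis
    using mult_character_power[OF mult_character_teichmuller, of x] by (metis teichmuller_1)
qed

text \<open>The value is a square root of 1 in a field, and it differs from 1 by injectivity since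
  -1 and 1 are distinct in odd characteristic.\<close>

lemma teichmuller_minus_1:
  assumes "odd CARD('p::prime_card)"
  shows "teichmuller (-1 :: 'p::prime_card mod_ring) = -1"
proof -
  have "(-1 :: 'p mod_ring) \<noteq> 1"
  proof
    assume "(-1 :: 'p mod_ring) = 1"
    then have "(of_int (-1) :: 'p mod_ring) = of_int 1"
      by simp
    then have "int CARD('p) dvd 2"
      unfolding of_int_mod_ring_eq_iff by (simp add: cong_iff_dvd_diff)
    then have "CARD('p) dvd 2"
      by (metis int_dvd_int_iff of_nat_numeral)
    with assms show False
      using primes_dvd_imp_eq[OF prime_card[where 'a = 'p] two_is_prime_nat] by auto
  qed
  then have "teichmuller (-1 :: 'p mod_ring) \<noteq> 1"
    by (metis teichmuller_1 teichmuller_eq_iff)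
  moreover have "(teichmuller (-1 :: 'p mod_ring))\<^sup>2 = 1"
    by (simp add: power2_eq_square flip: teichmuller_mult)
  ultimately show ?thesis
    by (simp add: power2_eq_1_iff)
qed

section \<open>The reflection of the summation index\<close>

text \<open>A single factor of the product in \<open>padic_G\<close>, as a function of t = j/(p -
  1), so that the reflection can be stated for rational t.\<close>

definition padic_G_factor :: "rat \<Rightarrow> rat \<Rightarrow> rat \<Rightarrow> 'p::prime_card padic" where
  "padic_G_factor a b t =
     padic_Gamma_rat (frac (a - t)) / padic_Gamma_rat (frac a) *
     (padic_Gamma_rat (frac (- b + t)) / padic_Gamma_rat (frac (- b))) *
     (- of_nat CARD('p)) powi (- \<lfloor>frac a - t\<rfloor> - \<lfloor>frac (- b) + t\<rfloor>)"

lemma padic_G_conv_factor: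
  "(padic_G as bs s :: 'p::prime_card padic) = - 1 / of_nat (CARD('p) - 1) *
     (\<Sum>j = 0..CARD('p) - 2. (- 1) ^ (j * length as) * character_power teichmuller_bar j s *
       (\<Prod>i<length as. padic_G_factor (as ! i) (bs ! i) (of_nat j / of_nat (CARD('p) - 1))))"
  by (simp only: padic_G_def padic_G_factor_def Let_def)

lemma prod_lessThan_append_pair:
  fixes f :: "'a \<Rightarrow> 'b \<Rightarrow> 'c::comm_monoid_mult"
  assumes "n \<ge> 2"
  shows "(\<Prod>i<n. f ((replicate (n - 2) a @ [a1, a2]) ! i) ((replicate (n - 2) b @ [b1, b2]) ! i))
    = f a b ^ (n - 2) * f a1 b1 * f a2 b2"
proof -
  obtain m where n: "n = Suc (Suc m)"
    using assms by (metis Suc_le_D numeral_2_eq_2 Suc_le_mono)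
  show ?thesis
    by (simp add: n nth_append)
qed

text \<open>Brings constant parameter lists to the shape of the lists ending in 1/4, 3/4, so that
  \<open>prod_lessThan_append_pair\<close> applies to both.\<close>

lemma replicate_eq_append_pair: "n \<ge> 2 \<Longrightarrow> replicate n x = replicate (n - 2) x @ [x, x]"
  by (cases n; cases "n - 1") (simp_all add: replicate_app_Cons_same replicate_append_same)

lemma frac_eqI: "x = y + of_int k \<Longrightarrow> 0 \<le> y \<Longrightarrow> y < 1 \<Longrightarrow> frac x = y"
  by (simp add: frac_unique_iff)

lemma frac_rat_values:
  "frac (1/2 :: rat) = 1/2" "frac (1/4 :: rat) = 1/4" "frac (3/4 :: rat) = 3/4"
  "frac (- 1 :: rat) = 0" "frac (- (1/4) :: rat) = 3/4" "frac (- (3/4) :: rat) = 1/4"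
  using frac_eqI[of "1/2 :: rat" "1/2" 0] frac_eqI[of "1/4 :: rat" "1/4" 0]
    frac_eqI[of "3/4 :: rat" "3/4" 0] frac_eqI[of "- 1 :: rat" 0 "-1"]
    frac_eqI[of "- (1/4) :: rat" "3/4" "-1"] frac_eqI[of "- (3/4) :: rat" "1/4" "-1"]
  by simp_all

text \<open>Since u is 1/2 - t up to an integer k, each argument in u is an integer shift of one in
  t. In the last identity the shifts by k cancel and a single 1 remains, the source of the extra
  power of -p.\<close>

lemma half_reflection:
  fixes t u :: rat
  assumes "0 \<le> t" "t < 1" "u = (if t \<le> 1/2 then 1/2 - t else 3/2 - t)"
  shows "frac (1/2 - t) = u" "frac (1/2 - u) = t" "frac (-1 + t) = t" "frac (-1 + u) = u"
    "frac (- (1/4) + u) = frac (1/4 - t)" "frac (- (3/4) + u) = frac (3/4 - t)"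
    "\<lfloor>1/2 - u\<rfloor> = \<lfloor>1/2 - t\<rfloor>" "\<lfloor>t\<rfloor> = 0" "\<lfloor>u\<rfloor> = 0"
    "2 * \<lfloor>1/2 - u\<rfloor> + \<lfloor>3/4 + u\<rfloor> + \<lfloor>1/4 + u\<rfloor> = \<lfloor>1/4 - t\<rfloor> + \<lfloor>3/4 - t\<rfloor> + 1"
proof -
  have "0 \<le> u" "u < 1"
    using assms by auto
  show "\<lfloor>t\<rfloor> = 0" and "\<lfloor>u\<rfloor> = 0"
    using assms \<open>0 \<le> u\<close> \<open>u < 1\<close> by (simp_all add: floor_eq_iff)
  have shift: "\<lfloor>x + of_int k\<rfloor> = \<lfloor>x\<rfloor> + k" "frac (x + of_int k) = frac x" for x :: rat and k
    by (simp_all add: frac_def)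
  \<comment> \<open>The integer k is 0 for t \<le> 1/2 and 1 otherwise.\<close>
  obtain k :: int where k: "u = 1/2 - t + of_int k" "\<lfloor>1/2 - t\<rfloor> = - k"
  proof (cases "t \<le> 1/2")
    case True
    with assms show ?thesis by (intro that[of 0]) (auto simp: floor_eq_iff)
  next
    case False
    with assms show ?thesis by (intro that[of 1]) (auto simp: floor_eq_iff)
  qed
  show "frac (1/2 - t) = u" "frac (1/2 - u) = t" "frac (-1 + t) = t" "frac (-1 + u) = u"
    using assms(1,2) \<open>0 \<le> u\<close> \<open>u < 1\<close> k(1)
    by (auto intro: frac_eqI[where k = "- k"] frac_eqI[where k = "-1"])
  have "1/2 - u = t + of_int (- k)"
    by (simp add: k(1))
  then show half: "\<lfloor>1/2 - u\<rfloor> = \<lfloor>1/2 - t\<rfloor>"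
    using \<open>\<lfloor>t\<rfloor> = 0\<close> by (simp only: shift k(2))
  have eqs: "- (1/4) + u = (1/4 - t) + of_int k" "- (3/4) + u = (3/4 - t) + of_int (k - 1)"
    "3/4 + u = (1/4 - t) + of_int (k + 1)" "1/4 + u = (3/4 - t) + of_int k"
    by (simp_all add: k(1))
  show "frac (- (1/4) + u) = frac (1/4 - t)" "frac (- (3/4) + u) = frac (3/4 - t)"
    "2 * \<lfloor>1/2 - u\<rfloor> + \<lfloor>3/4 + u\<rfloor> + \<lfloor>1/4 + u\<rfloor> = \<lfloor>1/4 - t\<rfloor> + \<lfloor>3/4 - t\<rfloor> + 1"
    unfolding half k(2) by (simp_all only: eqs shift)
qed

text \<open>Reflection swaps the two gamma arguments of a half factor. For the quarter factors the
  arguments match as well, but the normalisations differ by Gamma_p(1/2)^2 = -\<epsilon> and the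
  exponents of -p by one; the two minus signs cancel.\<close>

lemma padic_G_factor_reflect:
  fixes t u :: rat
  assumes "odd CARD('p::prime_card)" "0 \<le> t" "t < 1" "u = (if t \<le> 1/2 then 1/2 - t else 3/2 - t)"
  shows "padic_G_factor (1/2) 1 t = (padic_G_factor (1/2) 1 u :: 'p::prime_card padic)" (is ?half)
    and "padic_G_factor (1/4) 1 t * padic_G_factor (3/4) 1 t
      = (-1) ^ ((CARD('p) - 1) div 2) * of_nat CARD('p) *
        (padic_G_factor (1/2) (1/4) u * padic_G_factor (1/2) (3/4) u :: 'p::prime_card padic)"
      (is ?quarters)
proof -
  note refl = half_reflection[OF assms(2-4)]
  show ?half
    unfolding padic_G_factor_def frac_rat_values refl(1-4,7) by (simp add: refl(8,9) mult_ac)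
  define P :: "'p padic" where "P = - of_nat CARD('p)"
  have "P \<noteq> 0"
    by (simp add: P_def)
  define G :: "rat \<Rightarrow> 'p padic" where "G = padic_Gamma_rat"
  define \<epsilon> :: "'p padic" where "\<epsilon> = (-1) ^ ((CARD('p) - 1) div 2)"
  have \<epsilon>: "\<epsilon> * \<epsilon> = 1"
    by (simp add: \<epsilon>_def flip: power_mult_distrib)
  then have "\<epsilon> \<noteq> 0"
    by auto
  have G0: "G 0 = 1" and Gh: "G (1/2) * G (1/2) = - \<epsilon>"
    using padic_Gamma_rat_0[OF assms(1)] padic_Gamma_rat_half_square[OF assms(1)]
    by (simp_all add: G_def \<epsilon>_def power2_eq_square)
  define e where "e = \<lfloor>1/4 - t\<rfloor> + \<lfloor>3/4 - t\<rfloor>"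
  \<comment> \<open>The gamma quotient shared by both sides; the reflected side is divided further
    by Gamma_p(1/2)^2.\<close>
  define C where "C = G (frac (1/4 - t)) * G (frac (3/4 - t)) / (G (1/4) * G (3/4)) * (G t * G t)"
  have "padic_G_factor (1/4) 1 t * padic_G_factor (3/4) 1 t
      = C * (P powi (- \<lfloor>1/4 - t\<rfloor>) * P powi (- \<lfloor>3/4 - t\<rfloor>))"
    unfolding padic_G_factor_def frac_rat_values refl(3) G_def[symmetric] P_def[symmetric] G0 C_def
    by (simp add: refl(8) mult_ac)
  also have "P powi (- \<lfloor>1/4 - t\<rfloor>) * P powi (- \<lfloor>3/4 - t\<rfloor>) = P powi (- e)"
    using \<open>P \<noteq> 0\<close> by (simp add: e_def flip: power_int_add)
  finally have lhs: "padic_G_factor (1/4) 1 t * padic_G_factor (3/4) 1 t = C * P powi (- e)" .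
  have "padic_G_factor (1/2) (1/4) u * padic_G_factor (1/2) (3/4) u
      = C / (G (1/2) * G (1/2)) *
        (P powi (- \<lfloor>1/2 - u\<rfloor> - \<lfloor>3/4 + u\<rfloor>) * P powi (- \<lfloor>1/2 - u\<rfloor> - \<lfloor>1/4 + u\<rfloor>))"
    unfolding padic_G_factor_def frac_rat_values refl(2,5,6) G_def[symmetric] P_def[symmetric] C_def
    by (simp add: mult_ac)
  also have "P powi (- \<lfloor>1/2 - u\<rfloor> - \<lfloor>3/4 + u\<rfloor>) * P powi (- \<lfloor>1/2 - u\<rfloor> - \<lfloor>1/4 + u\<rfloor>)
      = P powi (- (2 * \<lfloor>1/2 - u\<rfloor> + \<lfloor>3/4 + u\<rfloor> + \<lfloor>1/4 + u\<rfloor>))"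
    unfolding power_int_add[OF disjI1, OF \<open>P \<noteq> 0\<close>, symmetric]
    by (rule arg_cong[where f = "(powi) P"]) simp
  also have "\<dots> = P powi (- e - 1)"
    unfolding refl(10) e_def by (rule arg_cong[where f = "(powi) P"]) simp
  also have "\<dots> = P powi (- e) / P"
    using \<open>P \<noteq> 0\<close> by (simp add: power_int_diff)
  finally have "padic_G_factor (1/2) (1/4) u * padic_G_factor (1/2) (3/4) u
      = C / (- \<epsilon>) * (P powi (- e) / P)"
    unfolding Gh .
  then show ?quarters
    using \<epsilon> \<open>P \<noteq> 0\<close> \<open>\<epsilon> \<noteq> 0\<close> unfolding lhs \<epsilon>_def[symmetric]
    by (simp add: P_def field_simps)
qed

section \<open>Matching the two sums term by term\<close>

definition reflect_index :: "nat \<Rightarrow> nat \<Rightarrow> nat" where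
  "reflect_index h j = (if j \<le> h then h - j else 3 * h - j)"

text \<open>On this range \<open>reflect_index h j\<close> is the residue of h - j modulo 2 * h,
  which makes the map an involution.\<close>

lemma bij_betw_reflect_index: "bij_betw (reflect_index h) {..<2 * h} {..<2 * h}"
  by (rule bij_betwI[where g = "reflect_index h"]) (auto simp: reflect_index_def)

theorem theorem2p7:
  fixes n :: nat and s :: "'p::prime_card mod_ring"
  assumes "2 \<le> n" and "odd CARD('p)" and "s \<noteq> 0"
  shows "padic_G (replicate (n - 2) (1/2) @ [1/4, 3/4]) (replicate n 1) s
    = of_nat CARD('p) * character_power teichmuller ((CARD('p) - 1) div 2) ((- 1) ^ (n + 1) * s) *
      padic_G (replicate n (1/2)) (replicate (n - 2) 1 @ [1/4, 3/4]) (inverse s)"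
proof -
  define h where "h = (CARD('p) - 1) div 2"
  have card: "CARD('p) - 1 = 2 * h"
    using assms(2) by (simp add: h_def)
  have "h > 0"
    using card nontriv[where 'a = 'p] by (cases h) auto
  then have range: "{0..CARD('p) - 2} = {..<2 * h}"
    using card by auto
  define w where "w = teichmuller s"
  have w: "w ^ (2 * h) = 1"
    using teichmuller_power_card_minus_1[OF assms(3)] by (simp only: card w_def)
  then have "w \<noteq> 0"
    using \<open>h > 0\<close> by (auto simp: power_0_left)
  \<comment> \<open>Passing to the inverse of s turns the inverse character back into the character
    itself.\<close>
  have bar: "character_power teichmuller_bar j s = inverse w ^ j"
    "character_power teichmuller_bar j (inverse s) = w ^ j" for j
    using assms(3) by (simp_all add: character_power_def teichmuller_bar_def w_def teichmuller_inverse)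
  have char: "character_power teichmuller h ((- 1) ^ (n + 1) * s) = ((-1) ^ (n + 1)) ^ h * w ^ h"
    using assms(3)
    by (simp add: character_power_def teichmuller_mult mult_character_power[OF mult_character_teichmuller]
        teichmuller_minus_1[OF assms(2)] w_def power_mult_distrib del: power_Suc)
  define F :: "rat \<Rightarrow> rat \<Rightarrow> nat \<Rightarrow> 'p padic"
    where "F a b j = padic_G_factor a b (of_nat j / of_nat (2 * h))" for a b j
  define L where "L j = (-1) ^ (j * n) * inverse w ^ j *
    (F (1/2) 1 j ^ (n - 2) * F (1/4) 1 j * F (3/4) 1 j)" for j
  define R where "R j = (-1) ^ (j * n) * w ^ j *
    (F (1/2) 1 j ^ (n - 2) * F (1/2) (1/4) j * F (1/2) (3/4) j)" for j
  have summand: "L j = of_nat CARD('p) * (((-1) ^ (n + 1)) ^ h * w ^ h) * R (reflect_index h j)"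
    if j: "j < 2 * h" for j
  proof -
    let ?k = "reflect_index h j"
    define t u :: rat where "t = of_nat j / of_nat (2 * h)" and "u = of_nat ?k / of_nat (2 * h)"
    have t: "0 \<le> t" "t < 1"
      using j by (simp_all add: t_def)
    have u: "u = (if t \<le> 1/2 then 1/2 - t else 3/2 - t)"
    proof -
      have "t \<le> 1/2 \<longleftrightarrow> j \<le> h"
        using \<open>h > 0\<close> by (simp add: t_def divide_simps)
      then show ?thesis
        using \<open>h > 0\<close> j by (auto simp: t_def u_def reflect_index_def of_nat_diff field_simps)
    qed
    note factors = padic_G_factor_reflect[OF assms(2) t u, folded h_def,
        unfolded t_def u_def, folded F_def]
    \<comment> \<open>The sum of j and its reflection is h or 3 * h; c supplies the missing multiple
      of 2 * h, so both cases share one equation.\<close>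
    obtain c where c: "j + ?k + 2 * h * c = 3 * h" "c \<le> 1"
      using j by (intro that[of "if j \<le> h then 1 else 0"]) (auto simp: reflect_index_def)
    have "w ^ h * w ^ ?k * w ^ j = 1"
    proof -
      have "w ^ h * w ^ ?k * w ^ j = w ^ h * w ^ ?k * w ^ j * (w ^ (2 * h)) ^ c"
        by (simp add: w)
      also have "\<dots> = w ^ (h + (j + ?k + 2 * h * c))"
        by (simp only: power_add mult_ac flip: power_mult)
      also have "\<dots> = (w ^ (2 * h)) ^ 2"
        unfolding c(1) by (simp flip: power_mult)
      finally show ?thesis by (simp add: w)
    qed
    then have ch: "inverse w ^ j = w ^ h * w ^ ?k"
      using \<open>w \<noteq> 0\<close> by (simp add: field_simps power_inverse)
    \<comment> \<open>Adding the even number 2 * h * c * n turns the sum into 4 * h * n.\<close>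
    have "even (j * n + (n * h + ?k * n))"
    proof -
      have "j * n + (n * h + ?k * n) + 2 * h * c * n = (j + ?k + 2 * h * c) * n + n * h"
        by (simp add: algebra_simps)
      also have "\<dots> = 2 * (2 * h * n)"
        unfolding c(1) by (simp add: algebra_simps)
      finally show ?thesis
        by (metis dvd_triv_left even_add mult.assoc)
    qed
    then have "(-1 :: 'p padic) ^ (j * n) = (-1) ^ (n * h + ?k * n)"
      by (simp add: minus_one_power_iff)
    \<comment> \<open>The extra (-1)^h comes from the quarter factors and completes n * h to (n + 1)
      * h, the sign of the character at (-1)^(n + 1).\<close>
    then have "(-1 :: 'p padic) ^ (j * n) * (-1) ^ h = (-1) ^ ((n + 1) * h) * (-1) ^ (?k * n)"
      by (simp add: algebra_simps power_add)
    then have sign: "(-1 :: 'p padic) ^ (j * n) * (-1) ^ h = ((-1) ^ (n + 1)) ^ h * (-1) ^ (?k * n)"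
      by (simp only: power_mult)
    have "L j = ((-1) ^ (j * n) * (-1) ^ h) * inverse w ^ j * of_nat CARD('p) *
        (F (1/2) 1 ?k ^ (n - 2) * F (1/2) (1/4) ?k * F (1/2) (3/4) ?k)"
      unfolding L_def factors(1) mult.assoc factors(2) by (simp only: mult_ac)
    also have "\<dots> = of_nat CARD('p) * (((-1) ^ (n + 1)) ^ h * w ^ h) * R ?k"
      unfolding sign ch R_def by (simp only: mult_ac)
    finally show ?thesis .
  qed
  have "(\<Sum>j<2 * h. L j)
      = (\<Sum>j<2 * h. of_nat CARD('p) * (((-1) ^ (n + 1)) ^ h * w ^ h) * R (reflect_index h j))"
    using summand by (intro sum.cong) auto
  also have "\<dots> = (\<Sum>j<2 * h. of_nat CARD('p) * (((-1) ^ (n + 1)) ^ h * w ^ h) * R j)"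
    by (rule sum.reindex_bij_betw[OF bij_betw_reflect_index])
  finally have sums: "(\<Sum>j<2 * h. L j)
      = of_nat CARD('p) * (((-1) ^ (n + 1)) ^ h * w ^ h) * (\<Sum>j<2 * h. R j)"
    by (simp add: sum_distrib_left)
  have len: "length (replicate (n - 2) x @ [y, z]) = n" for x y z :: rat
    using assms(1) by simp
  have lhs: "padic_G (replicate (n - 2) (1/2) @ [1/4, 3/4]) (replicate n 1) s
      = - 1 / of_nat (2 * h) * (\<Sum>j<2 * h. L j)"
    unfolding padic_G_conv_factor len replicate_eq_append_pair[OF assms(1)] range card bar
      prod_lessThan_append_pair[OF assms(1), where f = "\<lambda>a b. padic_G_factor a b _"] L_def F_def ..
  have rhs: "padic_G (replicate n (1/2)) (replicate (n - 2) 1 @ [1/4, 3/4]) (inverse s)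
      = - 1 / of_nat (2 * h) * (\<Sum>j<2 * h. R j)"
    unfolding padic_G_conv_factor len replicate_eq_append_pair[OF assms(1)] range card bar
      prod_lessThan_append_pair[OF assms(1), where f = "\<lambda>a b. padic_G_factor a b _"] R_def F_def ..
  show ?thesis
    unfolding lhs rhs sums char h_def[symmetric] by (simp only: mult_ac)
qed

end
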